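(* Let $X=X_\Sigma$ be the $n$-dimensional toric variety of a complete fan $\Sigma$ in $\mathbb{R}^n$ with $k$ rays, with Cox ring $S=\mathbb{C}[x_1,\dots,x_k]$ and canonical form $\Omega_X$. Let $f,g\in S$ be nonzero homogeneous polynomials with positive real coefficients and of the same degree in $\mathrm{Cl}(X)$. Suppose that the Newton polytope $\mathcal{N}(g)\subset\mathbb{R}^k$ is $n$-dimensional and contains the Newton polytope $\mathcal{N}(f)$ in its relative interior. Then the integral $$\mathcal{I}=\int_{X_{>0}}\frac{f}{g}\,\Omega_X$$ converges.
   Context: Let $\Sigma$ be a complete rational polyhedral fan in $\mathbb{R}^n$ with $k$ rays, with primitive ray generators $v_1,\dots,v_k\in\mathbb{Z}^n$, and let $V=[v_1\,\cdots\,v_k]\in\mathbb{Z}^{n\times k}$. Let $X=X_\Sigma$ be the associated normal complete toric variety with dense torus $T=(\mathbb{C}^* )^n$ (coordinates $t_1,\dots,t_n$). Its Cox ring is $S=\mathbb{C}[x_1,\dots,x_k]$, graded by $\mathrm{Cl}(X)=\mathbb{Z}^k/\mathrm{im}(V^\top)$ with $\deg x_i$ the class of the $i$-th unit vector. The Cox quotient map $\pi:\mathbb{C}^k\setminus\mathcal{V}(B)\to X$, where $B=\langle\prod_{v_i\notin\sigma}x_i : \sigma\in\Sigma(n)\rangle$, is given on $(\mathbb{C}^* )^k$ by the monomial map $x\mapsto(\prod_i x_i^{(v_i)_j})_{j=1,\dots,n}\in T$. The positive part is $X_{>0}=\pi(\mathbb{R}^k_{>0})$; it is identified with $T_{>0}=\mathbb{R}^n_{>0}$.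 If $f,g\in S$ are homogeneous of the same degree, then $f/g$ is constant on the fibres of $\pi:\mathbb{R}^k_{>0}\to X_{>0}$ (where defined) and hence is viewed as a function on $X_{>0}$. The canonical form is $$\Omega_X=\sum_{I\subset\{1,\dots,k\},\,|I|=n}\det(V_I)\bigwedge_{i\in I}\frac{\mathrm{d}x_i}{x_i},$$ where $V_I$ is the submatrix of $V$ with columns indexed by $I$; it is the pullback under $\pi$ of $\bigwedge_{j=1}^n \mathrm{d}t_j/t_j$ and is viewed as a form on $X$; $X_{>0}$ is oriented so that it is positive. The Newton polytope of a polynomial is the convex hull of its exponent vectors. *)

theory Defs
  imports "HOL-Analysis.Analysis" "HOL-Library.Poly_Mapping"
begin

text \<open>
  The dimension n is \<open>CARD('n)\<close>, the number of rays k is \<open>CARD('k)\<close>. The matrix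
  \<open>V :: int ^ 'k ^ 'n\<close> has n rows and k columns; the ray generators are its columns.
\<close>

definition real_vec :: "int ^ 'd \<Rightarrow> real ^ 'd" where
  "real_vec a = (\<chi> j. real_of_int (a $ j))"


section \<open>Fans\<close>

definition rational_polyhedral_cone :: "(real ^ 'n::finite) set \<Rightarrow> bool" where
  "rational_polyhedral_cone \<sigma> \<longleftrightarrow>
     (\<exists>A :: (int ^ 'n) set. finite A \<and> \<sigma> = convex_cone hull (real_vec ` A))"

definition strongly_convex :: "(real ^ 'n::finite) set \<Rightarrow> bool" where
  "strongly_convex \<sigma> \<longleftrightarrow> \<sigma> \<inter> uminus ` \<sigma> = {0}"

text \<open>The library relation \<open>face_of\<close> admits the empty face, which is not a cone.\<close>

definition fan :: "(real ^ 'n::finite) set set \<Rightarrow> bool" where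
  "fan \<F> \<longleftrightarrow> finite \<F> \<and>
     (\<forall>\<sigma>\<in>\<F>. rational_polyhedral_cone \<sigma> \<and> strongly_convex \<sigma>) \<and>
     (\<forall>\<sigma>\<in>\<F>. \<forall>\<tau>. \<tau> face_of \<sigma> \<and> \<tau> \<noteq> {} \<longrightarrow> \<tau> \<in> \<F>) \<and>
     (\<forall>\<sigma>\<in>\<F>. \<forall>\<tau>\<in>\<F>. \<sigma> \<inter> \<tau> face_of \<sigma> \<and> \<sigma> \<inter> \<tau> face_of \<tau>)"

definition complete_fan :: "(real ^ 'n::finite) set set \<Rightarrow> bool" where
  "complete_fan \<F> \<longleftrightarrow> fan \<F> \<and> \<Union>\<F> = UNIV"

definition fan_rays :: "(real ^ 'n::finite) set set \<Rightarrow> (real ^ 'n) set set" where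
  "fan_rays \<F> = {\<rho> \<in> \<F>. aff_dim \<rho> = 1}"

definition primitive :: "int ^ 'n::finite \<Rightarrow> bool" where
  "primitive a \<longleftrightarrow> Gcd (range (\<lambda>j. a $ j)) = 1"

definition ray_matrix :: "(real ^ 'n::finite) set set \<Rightarrow> int ^ 'k::finite ^ 'n \<Rightarrow> bool" where
  "ray_matrix \<F> V \<longleftrightarrow>
     (\<forall>i. primitive (column i V)) \<and>
     bij_betw (\<lambda>i. convex_cone hull {real_vec (column i V)}) UNIV (fan_rays \<F>)"


section \<open>The Cox ring and its grading\<close>

type_synonym 'k cox_ring = "('k \<Rightarrow>\<^sub>0 nat) \<Rightarrow>\<^sub>0 complex"

definition eval_poly :: "'k::finite cox_ring \<Rightarrow> complex ^ 'k \<Rightarrow> complex" where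
  "eval_poly f x =
     (\<Sum>m\<in>Poly_Mapping.keys f. Poly_Mapping.lookup f m * (\<Prod>i\<in>UNIV. x $ i ^ Poly_Mapping.lookup m i))"

text \<open>Classes in \<open>\<int>\<^sup>k / im(V\<^sup>T)\<close> are represented as cosets of \<open>im(V\<^sup>T)\<close>.\<close>

definition divisor_class :: "int ^ 'k::finite ^ 'n::finite \<Rightarrow> int ^ 'k \<Rightarrow> (int ^ 'k) set" where
  "divisor_class V a = range (\<lambda>m. a + transpose V *v m)"

definition class_group :: "int ^ 'k::finite ^ 'n::finite \<Rightarrow> (int ^ 'k) set set" where
  "class_group V = range (divisor_class V)"

definition monomial_degree :: "int ^ 'k::finite ^ 'n::finite \<Rightarrow> ('k \<Rightarrow>\<^sub>0 nat) \<Rightarrow> (int ^ 'k) set" where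
  "monomial_degree V m = divisor_class V (\<chi> i. int (Poly_Mapping.lookup m i))"

definition homogeneous ::
  "int ^ 'k::finite ^ 'n::finite \<Rightarrow> (int ^ 'k) set \<Rightarrow> 'k cox_ring \<Rightarrow> bool" where
  "homogeneous V D f \<longleftrightarrow> (\<forall>m\<in>Poly_Mapping.keys f. monomial_degree V m = D)"

definition positive_coeffs :: "'k cox_ring \<Rightarrow> bool" where
  "positive_coeffs f \<longleftrightarrow>
     (\<forall>m\<in>Poly_Mapping.keys f. Poly_Mapping.lookup f m \<in> \<real> \<and> 0 < Re (Poly_Mapping.lookup f m))"

definition newton_polytope :: "'k::finite cox_ring \<Rightarrow> (real ^ 'k) set" where
  "newton_polytope f =
     convex hull ((\<lambda>m. \<chi> i. real (Poly_Mapping.lookup m i)) ` Poly_Mapping.keys f)"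


section \<open>The positive part of the toric variety\<close>

definition positive_orthant :: "(real ^ 'd) set" where
  "positive_orthant = {x. \<forall>i. 0 < x $ i}"

text \<open>
  The Cox quotient map on the locus where all coordinates are nonzero, landing in the
  dense torus of \<open>X\<close>. Only its restriction to \<open>\<real>\<^sup>k\<^sub>>\<^sub>0\<close> is used.
\<close>

definition cox_map :: "int ^ 'k::finite ^ 'n::finite \<Rightarrow> real ^ 'k \<Rightarrow> real ^ 'n" where
  "cox_map V x = (\<chi> j. \<Prod>i\<in>UNIV. x $ i powi (V $ j $ i))"

definition positive_part :: "int ^ 'k::finite ^ 'n::finite \<Rightarrow> (real ^ 'n) set" where
  "positive_part V = cox_map V ` positive_orthant"


section \<open>Differential forms and the canonical form\<close>

text \<open>
  A differential n-form on (a subset of) \<open>real ^ 'd\<close> maps a point and an \<open>'n\<close>-indexed family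
  of tangent vectors to a scalar. Both the factors of an n-fold wedge product and the
  tangent vectors it is evaluated at are indexed by \<open>'n\<close>, so that no ordering of \<open>'n\<close> is needed.
\<close>

type_synonym ('n, 'd, 'c) diff_form = "real ^ 'd \<Rightarrow> ('n \<Rightarrow> real ^ 'd) \<Rightarrow> 'c"

definition wedge :: "('n::finite \<Rightarrow> 'v \<Rightarrow> real) \<Rightarrow> ('n \<Rightarrow> 'v) \<Rightarrow> real" where
  "wedge \<alpha> w = det (\<chi> a b. \<alpha> b (w a))"

definition dlog :: "real ^ 'd \<Rightarrow> 'd \<Rightarrow> real ^ 'd \<Rightarrow> real" where
  "dlog x i w = w $ i / x $ i"

text \<open>
  The summand for \<open>I\<close> involves listing the elements of \<open>I\<close>, both for the columns of
  \<open>V\<^sub>I\<close> and for the factors of the wedge product. Using the same listing \<open>e\<close> in both places,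
  the product does not depend on its choice.
\<close>

definition canonical_form ::
  "int ^ 'k::finite ^ 'n::finite \<Rightarrow> ('n, 'k, real) diff_form" where
  "canonical_form V x w =
     (\<Sum>I | card I = CARD('n).
        let e = (SOME e :: 'n \<Rightarrow> 'k. bij_betw e UNIV I)
        in of_int (det (\<chi> a b. V $ a $ e b)) * wedge (\<lambda>b. dlog x (e b)) w)"

text \<open>The form \<open>(f/g) \<Omega>\<^sub>X\<close> in Cox coordinates, on \<open>\<real>\<^sup>k\<^sub>>\<^sub>0\<close>.\<close>

definition cox_integrand ::
  "int ^ 'k::finite ^ 'n::finite \<Rightarrow> 'k cox_ring \<Rightarrow> 'k cox_ring \<Rightarrow> ('n, 'k, complex) diff_form" where
  "cox_integrand V f g x w =
     eval_poly f (\<chi> i. of_real (x $ i)) / eval_poly g (\<chi> i. of_real (x $ i)) *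
     of_real (canonical_form V x w)"

definition pullback ::
  "(real ^ 'd::finite \<Rightarrow> real ^ 'e::finite) \<Rightarrow> ('n, 'e, 'c) diff_form \<Rightarrow> ('n, 'd, 'c) diff_form" where
  "pullback \<phi> \<omega> x w = \<omega> (\<phi> x) (\<lambda>j. frechet_derivative \<phi> (at x) (w j))"

text \<open>
  Integrability of a top-degree form on \<open>U \<subseteq> \<real>\<^sup>n\<close>: its coefficient with respect to
  the standard volume form is Lebesgue integrable on \<open>U\<close>.
\<close>

definition form_integrable ::
  "(real ^ 'n::finite) set \<Rightarrow> ('n, 'n, complex) diff_form \<Rightarrow> bool" where
  "form_integrable U \<omega> \<longleftrightarrow> set_integrable lborel U (\<lambda>t. \<omega> t (\<lambda>j. axis j 1))"

text \<open>
  A form \<open>\<eta>\<close> in Cox coordinates is viewed as a form on \<open>X\<^sub>>\<^sub>0\<close> by descending it along the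
  Cox quotient map, i.e. as the form \<open>\<omega>\<close> whose pullback is \<open>\<eta>\<close>. If \<open>V\<close> has rank n, the quotient
  map is a submersion on \<open>\<real>\<^sup>k\<^sub>>\<^sub>0\<close>, so the values of \<open>\<omega>\<close> on \<open>X\<^sub>>\<^sub>0\<close> are uniquely determined by \<open>\<eta>\<close>.
\<close>

definition descends_to ::
  "int ^ 'k::finite ^ 'n::finite \<Rightarrow> ('n, 'k, complex) diff_form \<Rightarrow> ('n, 'n, complex) diff_form \<Rightarrow> bool" where
  "descends_to V \<eta> \<omega> \<longleftrightarrow> (\<forall>x\<in>positive_orthant. \<forall>w. pullback (cox_map V) \<omega> x w = \<eta> x w)"

definition integral_converges ::
  "int ^ 'k::finite ^ 'n::finite \<Rightarrow> ('n, 'k, complex) diff_form \<Rightarrow> bool" where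
  "integral_converges V \<eta> \<longleftrightarrow> (\<exists>\<omega>. descends_to V \<eta> \<omega> \<and> form_integrable (positive_part V) \<omega>)"

end

theory Submission
  imports Defs
begin

text \<open>
  In the coordinates \<open>y = log t\<close> on the torus the measure \<open>\<Prod>dt\<^sub>j/t\<^sub>j\<close> is Lebesgue measure, and the
  integral converges because \<open>f/g\<close> decays exponentially in \<open>norm y\<close>.

  The decay comes from the polytopes. Put \<open>l = log x\<close>, so that the monomial with exponent \<open>m\<close>
  takes the value \<open>exp (m \<bullet> l)\<close> and the Cox quotient map becomes the linear map
  \<open>l \<mapsto> V l = y\<close>. All exponents of \<open>f\<close> and \<open>g\<close> lie in one translate of the row space of \<open>V\<close>, and
  the Newton polytope of \<open>g\<close> spans it. An exponent \<open>p\<close> of \<open>f\<close> is relatively interior, so the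
  polytope contains points beyond \<open>p\<close> in every direction of the row space, in particular in the
  direction \<open>V\<^sup>T V l\<close> in which the functional \<open>l\<close> grows at a rate proportional to \<open>norm (V l)\<close>.
  Hence some exponent \<open>m\<close> of \<open>g\<close> satisfies \<open>m \<bullet> l \<ge> p \<bullet> l + d * norm y\<close> with \<open>d > 0\<close> independent
  of \<open>l\<close> (\<open>interior_exponent_gap\<close>). Positivity of the coefficients excludes cancellation in \<open>g\<close>,
  and \<open>x\<^sup>p / g(x) \<le> C exp (- d * norm y)\<close> follows (\<open>exp_exponent_ratio_bound\<close>).
  This majorant is integrable (\<open>exp_neg_norm_log_integrable\<close>).

  It remains to see that the form in Cox coordinates really is a form on the torus. The quotient
  \<open>f/g\<close> is constant on fibres (\<open>ratio_fibre\<close>); the canonical form is the pullback of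
  the wedge product of the \<open>dt\<^sub>j/t\<^sub>j\<close> by the Cauchy--Binet formula
  (\<open>canonical_form_eq_pullback\<close>). Full-dimensionality of the Newton polytope of \<open>g\<close> forces \<open>V\<close> to have rank n, so the quotient map is onto the positive
  orthant and a right inverse of \<open>V\<close> picks a point of each fibre.
\<close>


section \<open>The Cauchy--Binet formula\<close>

text \<open>
  Multilinearity in the rows: row \<open>i\<close> of \<open>A ** B\<close> is a combination of the rows of \<open>B\<close>, and
  \<open>f i\<close> records which of them is chosen.
\<close>

lemma det_matrix_mul_expand:
  fixes A :: "'c::comm_ring_1 ^ 'k::finite ^ 'n::finite" and B :: "'c ^ 'n ^ 'k"
  shows "det (A ** B) = (\<Sum>f\<in>UNIV. (\<Prod>i\<in>UNIV. A $ i $ f i) * det (\<chi> i. B $ f i))"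
proof -
  have "det (A ** B) = (\<Sum>p | p permutes UNIV. of_int (sign p) *
      (\<Sum>f\<in>UNIV. \<Prod>i\<in>UNIV. A $ i $ f i * B $ f i $ p i))"
    unfolding det_def matrix_matrix_mult_def
    by (simp add: prod_sum_PiE PiE_UNIV_domain)
  also have "\<dots> = (\<Sum>f\<in>UNIV. (\<Prod>i\<in>UNIV. A $ i $ f i) * det (\<chi> i. B $ f i))"
    unfolding det_def sum_distrib_left
    by (subst sum.swap) (simp add: prod.distrib mult_ac)
  finally show ?thesis .
qed

text \<open>
  In the row expansion, a choice of rows that repeats one contributes nothing. The injective
  choices are grouped by their image \<open>I\<close>; relative to a fixed listing of \<open>I\<close> they are the
  permutations, so that each group sums to a Leibniz formula for the minor of \<open>A\<close>. Any listing
  \<open>e I\<close> may be used, because the two minors change sign together.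
\<close>

theorem Cauchy_Binet:
  fixes A :: "'c::comm_ring_1 ^ 'k::finite ^ 'n::finite" and B :: "'c ^ 'n ^ 'k"
    and e :: "'k set \<Rightarrow> 'n \<Rightarrow> 'k"
  assumes e: "\<And>I. card I = CARD('n) \<Longrightarrow> bij_betw (e I) UNIV I"
  shows "det (A ** B) =
    (\<Sum>I | card I = CARD('n). det (\<chi> a b. A $ a $ e I b) * det (\<chi> a. B $ e I a))"
proof -
  define h where "h f = (\<Prod>i\<in>UNIV. A $ i $ f i) * det (\<chi> i. B $ f i)" for f :: "'n \<Rightarrow> 'k"
  have noninj: "h f = 0" if f: "\<not> inj f" for f
  proof -
    obtain i j where "i \<noteq> j" "f i = f j" using f by (auto simp: inj_def)
    then have "det (\<chi> i. B $ f i) = 0"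
      by (intro det_identical_rows[of i j]) (auto simp: row_def)
    then show ?thesis by (simp add: h_def)
  qed
  have fibre: "(\<Sum>f | inj f \<and> range f = I. h f) =
      det (\<chi> a b. A $ a $ e I b) * det (\<chi> a. B $ e I a)" if I: "card I = CARD('n)" for I
  proof -
    have eI: "inj (e I)" "range (e I) = I" using e[OF I] by (auto simp: bij_betw_def)
    have "bij_betw (\<lambda>p. e I \<circ> p) {p. p permutes UNIV} {f. inj f \<and> range f = I}"
    proof (intro bij_betwI[where g = "\<lambda>f. inv (e I) \<circ> f"])
      show "(\<lambda>p. e I \<circ> p) \<in> {p. p permutes UNIV} \<rightarrow> {f. inj f \<and> range f = I}"
      proof
        fix p :: "'n \<Rightarrow> 'n" assume "p \<in> {p. p permutes UNIV}"
        then have "inj p" "surj p" by (auto simp: permutes_inj permutes_surj)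
        then have "inj (e I \<circ> p)" "range (e I \<circ> p) = I"
          using eI by (metis inj_compose, metis image_comp)
        then show "e I \<circ> p \<in> {f. inj f \<and> range f = I}" by simp
      qed
      show "(\<lambda>f. inv (e I) \<circ> f) \<in> {f. inj f \<and> range f = I} \<rightarrow> {p. p permutes UNIV}"
      proof
        fix f :: "'n \<Rightarrow> 'k" assume f: "f \<in> {f. inj f \<and> range f = I}"
        have inj: "inj (inv (e I) \<circ> f)"
          using f eI by (auto simp: inj_def) (metis f_inv_into_f rangeI)
        then have "bij (inv (e I) \<circ> f)"
          by (simp only: bij_def finite_UNIV_inj_surj[OF finite_class.finite_UNIV])
        then show "inv (e I) \<circ> f \<in> {p. p permutes UNIV}"
          by (auto intro: bij_imp_permutes)
      qed
      show "inv (e I) \<circ> (e I \<circ> p) = p" for p using eI by (auto simp: fun_eq_iff)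
      show "e I \<circ> (inv (e I) \<circ> f) = f" if "f \<in> {f. inj f \<and> range f = I}" for f
        using that eI by (auto simp: fun_eq_iff f_inv_into_f)
    qed
    then have "(\<Sum>f | inj f \<and> range f = I. h f) = (\<Sum>p | p permutes UNIV. h (e I \<circ> p))"
      by (rule sum.reindex_bij_betw[symmetric])
    also have "\<dots> = (\<Sum>p | p permutes UNIV.
        of_int (sign p) * (\<Prod>i\<in>UNIV. A $ i $ e I (p i)) * det (\<chi> a. B $ e I a))"
    proof (rule sum.cong[OF refl])
      fix p :: "'n \<Rightarrow> 'n" assume "p \<in> {p. p permutes UNIV}"
      then have "p permutes UNIV" by simp
      from det_permute_rows[OF this, of "\<chi> a. B $ e I a"]
      have "det (\<chi> i. B $ e I (p i)) = of_int (sign p) * det (\<chi> a. B $ e I a)" by simp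
      then show "h (e I \<circ> p) = of_int (sign p) * (\<Prod>i\<in>UNIV. A $ i $ e I (p i)) * det (\<chi> a. B $ e I a)"
        by (simp add: h_def mult_ac)
    qed
    also have "\<dots> = det (\<chi> a b. A $ a $ e I b) * det (\<chi> a. B $ e I a)"
      by (simp add: det_def[of "\<chi> a b. A $ a $ e I b"] sum_distrib_right)
    finally show ?thesis .
  qed
  have "det (A ** B) = (\<Sum>f\<in>UNIV. h f)" by (simp add: det_matrix_mul_expand h_def)
  also have "\<dots> = (\<Sum>f | inj f. h f)"
    by (rule sum.mono_neutral_right) (auto simp: noninj)
  also have "\<dots> = (\<Sum>I | card I = CARD('n). \<Sum>f | f \<in> {f. inj f} \<and> range f = I. h f)"
    by (rule sum.group[symmetric]) (auto simp: card_image)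
  also have "\<dots> = (\<Sum>I | card I = CARD('n). det (\<chi> a b. A $ a $ e I b) * det (\<chi> a. B $ e I a))"
    using fibre by (intro sum.cong) auto
  finally show ?thesis .
qed


section \<open>Logarithmic coordinates on the positive orthant\<close>

definition log_vec :: "real ^ 'd \<Rightarrow> real ^ 'd" where
  "log_vec x = (\<chi> i. ln (x $ i))"

definition exp_vec :: "real ^ 'd \<Rightarrow> real ^ 'd" where
  "exp_vec y = (\<chi> i. exp (y $ i))"

lemma exp_vec_pos: "exp_vec y \<in> positive_orthant"
  by (simp add: exp_vec_def positive_orthant_def)

lemma log_exp_vec [simp]: "log_vec (exp_vec y) = y"
  by (simp add: exp_vec_def log_vec_def)

lemma exp_log_vec [simp]: "x \<in> positive_orthant \<Longrightarrow> exp_vec (log_vec x) = x"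
  by (simp add: exp_vec_def log_vec_def positive_orthant_def vec_eq_iff)

lemma open_positive_orthant: "open (positive_orthant :: (real ^ 'd::finite) set)"
proof -
  have eq: "(positive_orthant :: (real ^ 'd) set) = (\<Inter>i. {x. 0 < x $ i})"
    by (auto simp: positive_orthant_def)
  show ?thesis
    unfolding eq by (intro open_INT finite_class.finite_UNIV ballI open_Collect_less continuous_intros)
qed


section \<open>Integrability of exponential decay\<close>

text \<open>
  This is \<open>exp (- d * \<bar>y\<bar>)\<close> on the line after the substitution \<open>y = ln s\<close>. Splitting at \<open>s = 1\<close>
  leaves the power \<open>d - 1 > -1\<close> near zero and the power \<open>- d - 1 < -1\<close> near infinity.
\<close>

lemma nn_integral_exp_abs_ln_finite:
  assumes d: "(d::real) > 0"
  shows "(\<integral>\<^sup>+s. ennreal (indicator {0<..} s * (exp (- d * \<bar>ln s\<bar>) / s)) \<partial>lborel) < \<infinity>"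
proof -
  have 1: "integral\<^sup>N lborel (\<lambda>s. indicator {0..1} s * (s powr (d - 1))) < \<infinity>"
    using nn_integral_has_integral_lebesgue[OF _ has_integral_powr_from_0[of "d - 1" 1]] d
    by simp
  have 2: "integral\<^sup>N lborel (\<lambda>s. indicator {1..} s * (s powr (- d - 1))) < \<infinity>"
    using nn_integral_has_integral_lebesgue[OF _ has_integral_powr_to_inf[of "- d - 1" 1]] d
    by simp
  have "ennreal (indicator {0<..} s * (exp (- d * \<bar>ln s\<bar>) / s)) \<le>
      ennreal (indicator {0..1} s * (s powr (d - 1))) + ennreal (indicator {1..} s * (s powr (- d - 1)))" for s :: real
  proof (cases "s > 0")
    case True
    then have s: "exp (- ln s) = 1 / s" by (simp add: exp_minus inverse_eq_divide)
    have eq: "exp (- d * \<bar>ln s\<bar>) / s = s powr (if s \<le> 1 then d - 1 else - d - 1)"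
      using True s by (auto simp: powr_def exp_add exp_diff left_diff_distrib)
    show ?thesis
      unfolding eq using True by (cases "s \<le> 1") (auto simp: indicator_def)
  qed auto
  then have "(\<integral>\<^sup>+s. ennreal (indicator {0<..} s * (exp (- d * \<bar>ln s\<bar>) / s)) \<partial>lborel) \<le>
     (\<integral>\<^sup>+s. (ennreal (indicator {0..1} s * (s powr (d - 1))) + ennreal (indicator {1..} s * (s powr (- d - 1)))) \<partial>lborel)"
    by (intro nn_integral_mono) auto
  also have "\<dots> = integral\<^sup>N lborel (\<lambda>s. indicator {0..1} s * (s powr (d - 1))) + integral\<^sup>N lborel (\<lambda>s. indicator {1..} s * (s powr (- d - 1)))"
    by (intro nn_integral_add) auto
  also have "\<dots> < \<infinity>" using 1 2 by (simp add: ennreal_add_less_top)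
  finally show ?thesis .
qed

lemma prod_Basis_cart:
  fixes h :: "real ^ 'n::finite \<Rightarrow> 'a::comm_monoid_mult"
  shows "(\<Prod>b\<in>Basis. h b) = (\<Prod>i\<in>UNIV. h (axis i 1))"
proof -
  have "bij_betw (\<lambda>i. axis i 1 :: real ^ 'n) UNIV Basis"
    by (auto simp: bij_betw_def inj_def axis_eq_axis Basis_vec_def)
  then show ?thesis by (rule prod.reindex_bij_betw[symmetric])
qed

text \<open>
  Since \<open>norm y\<close> is at least the average of the \<open>\<bar>y\<^sub>j\<bar>\<close>, the exponential decay is dominated by a
  product of one-variable functions, whose integral is a product of finite integrals.
\<close>

lemma exp_neg_norm_log_integrable:
  fixes d :: real
  assumes d: "d > 0"
  shows "set_integrable lborel (positive_orthant :: (real ^ 'n::finite) set)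
    (\<lambda>t. exp (- d * norm (log_vec t)) / (\<Prod>j\<in>UNIV. t $ j))"
proof -
  define c where "c = d / CARD('n)"
  have c: "c > 0" using d by (simp add: c_def)
  define h where "h s = indicator {0<..} s * (exp (- c * \<bar>ln s\<bar>) / s)" for s :: real
  have h0: "h s \<ge> 0" for s by (simp add: h_def indicator_def)
  have hm[measurable]: "h \<in> borel_measurable borel" unfolding h_def by measurable
  have hint: "(\<integral>\<^sup>+s. ennreal (h s) \<partial>lborel) < \<infinity>"
    unfolding h_def by (rule nn_integral_exp_abs_ln_finite[OF c])
  have [measurable]: "(positive_orthant :: (real ^ 'n) set) \<in> sets borel"
    unfolding positive_orthant_def by measurable
  have "(\<integral>\<^sup>+t. (\<Prod>b\<in>Basis. ennreal (h (t \<bullet> b))) \<partial>(lborel :: (real^'n) measure)) =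
      (\<Prod>b\<in>(Basis :: (real^'n) set). \<integral>\<^sup>+s. ennreal (h s) \<partial>lborel)"
    by (rule nn_integral_lborel_prod) auto
  also have "\<dots> < \<infinity>" using hint by (simp add: power_less_top_ennreal)
  finally have "(\<integral>\<^sup>+t. ennreal (\<Prod>j\<in>UNIV. h (t $ j)) \<partial>(lborel :: (real^'n) measure)) < \<infinity>"
    by (simp add: prod_Basis_cart prod_ennreal h0 inner_axis)
  then have hi: "integrable lborel (\<lambda>t::real^'n. \<Prod>j\<in>UNIV. h (t $ j))"
    by (intro integrableI_nonneg) (auto intro!: prod_nonneg h0)
  show ?thesis
    unfolding set_integrable_def
  proof (rule Bochner_Integration.integrable_bound[OF hi])
    show "(\<lambda>x :: real ^ 'n. indicat_real positive_orthant x *\<^sub>R (exp (- d * norm (log_vec x)) / (\<Prod>j\<in>UNIV. x $ j)))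
      \<in> borel_measurable lborel"
      unfolding measurable_lborel2 log_vec_def
      by (intro borel_measurable_continuous_on_indicator continuous_intros)
        (auto simp: positive_orthant_def less_imp_neq[symmetric])
    show "AE x in (lborel :: (real ^ 'n) measure). norm (indicat_real positive_orthant x *\<^sub>R (exp (- d * norm (log_vec x)) / (\<Prod>j\<in>UNIV. x $ j)))
         \<le> norm (\<Prod>j\<in>UNIV. h (x $ j))"
    proof (intro AE_I2)
      fix x :: "real ^ 'n"
      show "norm (indicat_real positive_orthant x *\<^sub>R (exp (- d * norm (log_vec x)) / (\<Prod>j\<in>UNIV. x $ j)))
         \<le> norm (\<Prod>j\<in>UNIV. h (x $ j))"
      proof (cases "x \<in> positive_orthant")
        case True
        then have x: "x $ j > 0" for j by (simp add: positive_orthant_def)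
        have "(\<Sum>j\<in>(UNIV::'n set). \<bar>ln (x $ j)\<bar>) \<le> (\<Sum>j\<in>(UNIV::'n set). norm (log_vec x))"
          using component_le_norm_cart[of "log_vec x"] by (intro sum_mono) (simp add: log_vec_def)
        then have "c * (\<Sum>j\<in>UNIV. \<bar>ln (x $ j)\<bar>) \<le> d * norm (log_vec x)"
          using c by (simp add: c_def field_simps)
        then have "exp (- d * norm (log_vec x)) \<le> exp (\<Sum>j\<in>UNIV. - c * \<bar>ln (x $ j)\<bar>)"
          by (simp add: sum_distrib_left sum_negf)
        also have "\<dots> = (\<Prod>j\<in>UNIV. exp (- c * \<bar>ln (x $ j)\<bar>))" by (simp add: exp_sum)
        finally have "exp (- d * norm (log_vec x)) / (\<Prod>j\<in>UNIV. x $ j)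
           \<le> (\<Prod>j\<in>UNIV. exp (- c * \<bar>ln (x $ j)\<bar>)) / (\<Prod>j\<in>UNIV. x $ j)"
          using x by (intro divide_right_mono prod_nonneg) (auto intro: less_imp_le)
        also have "\<dots> = (\<Prod>j\<in>UNIV. h (x $ j))" using x by (simp add: h_def flip: prod_dividef)
        finally show ?thesis
          using True x by (simp add: abs_prod prod_pos less_imp_le h0)
      qed auto
    qed
  qed
qed


section \<open>Positive polynomials along the fibres of the Cox quotient map\<close>

definition exponent_vec :: "('k \<Rightarrow>\<^sub>0 nat) \<Rightarrow> real ^ 'k" where
  "exponent_vec m = (\<chi> i. real (Poly_Mapping.lookup m i))"

definition real_matrix :: "int ^ 'k ^ 'n \<Rightarrow> real ^ 'k ^ 'n" where
  "real_matrix V = (\<chi> j i. real_of_int (V $ j $ i))"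

text \<open>
  The value of \<open>f\<close> at the point with logarithm \<open>l\<close>. Taking real parts of the coefficients loses
  nothing when they are positive, and exponent vectors become linear functionals of \<open>l\<close>.
\<close>

definition log_eval :: "'k::finite cox_ring \<Rightarrow> real ^ 'k \<Rightarrow> real" where
  "log_eval f l = (\<Sum>m\<in>Poly_Mapping.keys f. Re (Poly_Mapping.lookup f m) * exp (exponent_vec m \<bullet> l))"

text \<open>In logarithmic coordinates the Cox quotient map is linear.\<close>

lemma cox_map_eq_exp:
  assumes "x \<in> positive_orthant"
  shows "cox_map V x = exp_vec (real_matrix V *v log_vec x)"
proof -
  have x: "x $ i > 0" for i using assms by (simp add: positive_orthant_def)
  have "x $ i powi n = exp (real_of_int n * ln (x $ i))" for i n
    using x[of i] by (simp add: powr_real_of_int'[symmetric] powr_def)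
  then show ?thesis
    by (simp add: cox_map_def exp_vec_def real_matrix_def log_vec_def matrix_vector_mult_def exp_sum)
qed

lemma eval_poly_positive:
  assumes f: "positive_coeffs f" and x: "x \<in> positive_orthant"
  shows "eval_poly f (\<chi> i. of_real (x $ i)) = of_real (log_eval f (log_vec x))"
proof -
  have mono: "(\<Prod>i\<in>UNIV. x $ i ^ Poly_Mapping.lookup m i) = exp (exponent_vec m \<bullet> log_vec x)" for m
    using x by (simp add: inner_vec_def exponent_vec_def log_vec_def positive_orthant_def exp_sum exp_of_nat_mult)
  have "Poly_Mapping.lookup f m = of_real (Re (Poly_Mapping.lookup f m))" if "m \<in> Poly_Mapping.keys f" for m
    using f that by (auto simp: positive_coeffs_def complex_is_Real_iff complex_eq_iff)
  then show ?thesis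
    unfolding eval_poly_def log_eval_def of_real_sum
    by (intro sum.cong) (simp_all flip: mono add: of_real_prod)
qed

lemma log_eval_pos:
  assumes "positive_coeffs f" "f \<noteq> 0"
  shows "log_eval f l > 0"
  unfolding log_eval_def using assms by (intro sum_pos) (auto simp: positive_coeffs_def)

lemma log_eval_ge:
  assumes "positive_coeffs g" "m \<in> Poly_Mapping.keys g"
  shows "Re (Poly_Mapping.lookup g m) * exp (exponent_vec m \<bullet> l) \<le> log_eval g l"
  unfolding log_eval_def using assms
  by (intro member_le_sum) (auto simp: positive_coeffs_def less_imp_le)

lemma same_degree_exponents:
  assumes "homogeneous V D f" "homogeneous V D g" "m \<in> Poly_Mapping.keys f" "m' \<in> Poly_Mapping.keys g"
  obtains u where "exponent_vec m = exponent_vec m' + transpose (real_matrix V) *v u"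
proof -
  have "monomial_degree V m = monomial_degree V m'" using assms by (simp add: homogeneous_def)
  moreover have "(\<chi> i. int (Poly_Mapping.lookup m i)) \<in> monomial_degree V m"
    unfolding monomial_degree_def divisor_class_def by (rule range_eqI[of _ _ 0]) simp
  ultimately obtain u where u: "(\<chi> i. int (Poly_Mapping.lookup m i)) =
      (\<chi> i. int (Poly_Mapping.lookup m' i)) + transpose V *v u"
    by (auto simp: monomial_degree_def divisor_class_def)
  have "real (Poly_Mapping.lookup m i) = real (Poly_Mapping.lookup m' i) +
     (\<Sum>j\<in>UNIV. real_of_int (V $ j $ i) * real_of_int (u $ j))" for i
  proof -
    have "int (Poly_Mapping.lookup m i) = int (Poly_Mapping.lookup m' i) + (\<Sum>j\<in>UNIV. V $ j $ i * u $ j)"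
      using arg_cong[OF u, of "\<lambda>v. v $ i"] by (simp add: matrix_vector_mult_def transpose_def)
    from arg_cong[OF this, of real_of_int] show ?thesis by simp
  qed
  then have "exponent_vec m = exponent_vec m' + transpose (real_matrix V) *v real_vec u"
    by (simp add: vec_eq_iff exponent_vec_def real_matrix_def real_vec_def matrix_vector_mult_def transpose_def)
  then show ?thesis by (rule that)
qed

text \<open>
  Exponents of equal degree differ by an element of the image of the transpose of \<open>V\<close>, which is
  orthogonal to the kernel of \<open>V\<close>. So along a fibre all monomials of one degree scale by a common
  factor. That factor depends only on the degree, hence it cancels in the quotient \<open>f/g\<close>.
\<close>

lemma log_eval_fibre:
  assumes f: "homogeneous V D f" and g: "homogeneous V D g" and m0: "m0 \<in> Poly_Mapping.keys g"
    and eq: "real_matrix V *v l = real_matrix V *v l'"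
  shows "log_eval f l = exp (exponent_vec m0 \<bullet> (l - l')) * log_eval f l'"
proof -
  have "exponent_vec m \<bullet> l = exponent_vec m0 \<bullet> (l - l') + exponent_vec m \<bullet> l'"
    if m: "m \<in> Poly_Mapping.keys f" for m
  proof -
    obtain u where u: "exponent_vec m = exponent_vec m0 + transpose (real_matrix V) *v u"
      using same_degree_exponents[OF f g m m0] by blast
    have "(transpose (real_matrix V) *v u) \<bullet> (l - l') = 0"
      unfolding transpose_matrix_vector dot_lmul_matrix
      using eq by (simp add: matrix_vector_mult_diff_distrib)
    then have "exponent_vec m \<bullet> (l - l') = exponent_vec m0 \<bullet> (l - l')"
      by (simp add: u inner_add_left)
    then show ?thesis by (simp add: inner_diff_right)
  qed
  then show ?thesis
    by (simp add: log_eval_def sum_distrib_left exp_add mult_ac cong: sum.cong)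
qed

lemma ratio_fibre:
  assumes "homogeneous V D f" "homogeneous V D g" "g \<noteq> 0"
    and "real_matrix V *v l = real_matrix V *v l'"
  shows "log_eval f l / log_eval g l = log_eval f l' / log_eval g l'"
proof -
  obtain m0 where "m0 \<in> Poly_Mapping.keys g" using \<open>g \<noteq> 0\<close> by fastforce
  from log_eval_fibre[OF assms(1,2) this assms(4)] log_eval_fibre[OF assms(2,2) this assms(4)]
  show ?thesis by simp
qed


section \<open>Decay of the quotient from the position of the Newton polytopes\<close>

lemma newton_polytope_eq: "newton_polytope f = convex hull (exponent_vec ` Poly_Mapping.keys f)"
  by (simp add: newton_polytope_def exponent_vec_def)

text \<open>
  By homogeneity the Newton polytope lies in a translate of the row space of \<open>V\<close>, of dimension
  at most n. If it is n-dimensional, then \<open>V\<close> has full rank and the polytope spans the whole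
  translate.
\<close>

lemma full_dim_newton_polytope:
  fixes V :: "int ^ 'k::finite ^ 'n::finite"
  assumes g: "homogeneous V D g" and m0: "m0 \<in> Poly_Mapping.keys g"
    and dim: "aff_dim (newton_polytope g) = int CARD('n)"
  shows "rank (real_matrix V) = CARD('n)"
    and "affine hull newton_polytope g =
      (+) (exponent_vec m0) ` range (\<lambda>u. transpose (real_matrix V) *v u)"
proof -
  let ?R = "range (\<lambda>u. transpose (real_matrix V) *v u)"
  let ?L = "(+) (exponent_vec m0) ` ?R"
  have sub: "subspace ?R"
    by (intro linear_subspace_image subspace_UNIV matrix_vector_mul_linear)
  have affL: "affine ?L"
    using sub affine_translation subspace_imp_affine by blast
  have dimL: "aff_dim ?L = int (rank (real_matrix V))"
    by (simp only: aff_dim_translation_eq aff_dim_subspace[OF sub] rank_transpose flip: rank_dim_range)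
  have "exponent_vec ` Poly_Mapping.keys g \<subseteq> ?L"
  proof safe
    fix m assume "m \<in> Poly_Mapping.keys g"
    from same_degree_exponents[OF g g this m0] show "exponent_vec m \<in> ?L" by blast
  qed
  then have hull: "affine hull newton_polytope g \<subseteq> ?L"
    unfolding newton_polytope_eq affine_hull_convex_hull using affL by (rule hull_minimal)
  then have "int CARD('n) \<le> aff_dim ?L"
    using aff_dim_subset[OF hull] dim by (simp only: aff_dim_affine_hull)
  then have "CARD('n) \<le> rank (real_matrix V)" using dimL by simp
  moreover have "rank (real_matrix V) \<le> CARD('n)"
    using rank_bound[of "real_matrix V"] by simp
  ultimately show r: "rank (real_matrix V) = CARD('n)" by simp
  show "affine hull newton_polytope g = ?L"
  proof (rule affine_dim_equal[OF _ affL _ hull])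
    show "affine hull newton_polytope g \<noteq> {}"
      using m0 by (auto simp: newton_polytope_eq)
    show "aff_dim (affine hull newton_polytope g) = aff_dim ?L"
      using dim dimL r by (simp only: aff_dim_affine_hull)
  qed simp
qed

text \<open>
  From the relatively interior point \<open>p\<close> one can move inside the polytope by a fixed distance in
  the direction \<open>z = V\<^sup>T V l\<close>, which is admissible since it lies in the row space of \<open>V\<close>. As
  \<open>z \<bullet> l = (norm (V l))\<^sup>2\<close> while \<open>norm z\<close> is at most a constant times \<open>norm (V l)\<close>, this gains a
  multiple of \<open>norm (V l)\<close> in the functional \<open>l\<close>, and the maximum of a functional on a polytope
  is attained at one of the spanning exponents.
\<close>

lemma interior_exponent_gap:
  fixes V :: "int ^ 'k::finite ^ 'n::finite"
  assumes g: "homogeneous V D g"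
    and dim: "aff_dim (newton_polytope g) = int CARD('n)"
    and p: "p \<in> rel_interior (newton_polytope g)"
  obtains d where "d > 0"
    "\<And>l. \<exists>m\<in>Poly_Mapping.keys g. p \<bullet> l + d * norm (real_matrix V *v l) \<le> exponent_vec m \<bullet> l"
proof -
  let ?A = "real_matrix V" and ?N = "newton_polytope g"
  have pN: "p \<in> ?N" using p rel_interior_subset by blast
  then obtain m0 where m0: "m0 \<in> Poly_Mapping.keys g" unfolding newton_polytope_eq by fastforce
  note hull = full_dim_newton_polytope(2)[OF g m0 dim]
  obtain e where e: "e > 0" "cball p e \<inter> affine hull ?N \<subseteq> ?N"
    using p by (auto simp: mem_rel_interior_cball)
  obtain K where K: "K > 0" "\<And>y. norm (transpose ?A *v y) \<le> norm y * K"
    using bounded_linear.pos_bounded[OF matrix_vector_mul_bounded_linear[of "transpose ?A"]] by blast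
  show ?thesis
  proof
    show "e / K > 0" using e K by simp
    fix l
    define y where "y = ?A *v l"
    define z where "z = transpose ?A *v y"
    have zl: "z \<bullet> l = norm y ^ 2"
      unfolding z_def transpose_matrix_vector dot_lmul_matrix
      by (simp add: y_def power2_norm_eq_inner)
    show "\<exists>m\<in>Poly_Mapping.keys g. p \<bullet> l + e / K * norm y \<le> exponent_vec m \<bullet> l"
    proof -
      \<comment> \<open>The step length scales \<open>z\<close> to norm at most \<open>e\<close>; for \<open>y = 0\<close> there is nothing to gain.\<close>
      define c where "c = (if y = 0 then 0 else e / (K * norm y))"
      have c0: "c \<ge> 0" using e K by (simp add: c_def)
      have "norm (c *\<^sub>R z) \<le> c * (norm y * K)"
        using K(2)[of y] c0 by (simp add: z_def mult_left_mono)
      also have "\<dots> \<le> e" using e K by (simp add: c_def)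
      finally have "p + c *\<^sub>R z \<in> cball p e" by (simp add: dist_norm)
      moreover have "p + c *\<^sub>R z \<in> affine hull ?N"
      proof -
        have "p \<in> affine hull ?N" using pN hull_inc by fast
        then obtain u where "p = exponent_vec m0 + transpose ?A *v u" unfolding hull by auto
        then have "p + c *\<^sub>R z = exponent_vec m0 + transpose ?A *v (u + c *\<^sub>R y)"
          by (simp add: z_def matrix_vector_right_distrib matrix_vector_mult_scaleR)
        then show ?thesis unfolding hull by blast
      qed
      ultimately have q: "p + c *\<^sub>R z \<in> convex hull (exponent_vec ` Poly_Mapping.keys g)"
        using e(2) by (auto simp: newton_polytope_eq)
      have cy: "c * norm y ^ 2 = e / K * norm y" by (simp add: c_def power2_eq_square)
      show ?thesis
      proof (rule ccontr)
        assume "\<not> ?thesis"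
        then have "exponent_vec ` Poly_Mapping.keys g \<subseteq> {v. l \<bullet> v < p \<bullet> l + e / K * norm y}"
          by (auto simp: inner_commute)
        then have "convex hull (exponent_vec ` Poly_Mapping.keys g) \<subseteq> {v. l \<bullet> v < p \<bullet> l + e / K * norm y}"
          by (intro hull_minimal convex_halfspace_lt)
        then have "l \<bullet> (p + c *\<^sub>R z) < p \<bullet> l + e / K * norm y" using q by blast
        then show False using zl cy by (simp add: inner_add_right inner_commute)
      qed
    qed
  qed
qed

text \<open>
  A positive polynomial is bounded below by each of its terms, in particular by one whose
  exponent exceeds \<open>p\<close> by \<open>d * norm (V l)\<close> in the functional \<open>l\<close>. Which term that is
  depends on \<open>l\<close>, so the constant is the reciprocal of the smallest coefficient.
\<close>

lemma exp_exponent_ratio_bound: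
  fixes V :: "int ^ 'k::finite ^ 'n::finite"
  assumes g: "homogeneous V D g" "positive_coeffs g" "g \<noteq> 0"
    and dim: "aff_dim (newton_polytope g) = int CARD('n)"
    and p: "p \<in> rel_interior (newton_polytope g)"
  obtains d C where "d > 0"
    "\<And>l. exp (p \<bullet> l) / log_eval g l \<le> C * exp (- d * norm (real_matrix V *v l))"
proof -
  obtain d where d: "d > 0" and gap:
    "\<And>l. \<exists>m\<in>Poly_Mapping.keys g. p \<bullet> l + d * norm (real_matrix V *v l) \<le> exponent_vec m \<bullet> l"
    using interior_exponent_gap[OF g(1) dim p] by metis
  define b where "b = Min ((\<lambda>m. Re (Poly_Mapping.lookup g m)) ` Poly_Mapping.keys g)"
  have ne: "Poly_Mapping.keys g \<noteq> {}" using g by simp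
  have b: "b > 0" using ne g(2) by (auto simp: b_def positive_coeffs_def)
  show ?thesis
  proof (rule that[OF d])
    fix l
    obtain m where m: "m \<in> Poly_Mapping.keys g"
      "p \<bullet> l + d * norm (real_matrix V *v l) \<le> exponent_vec m \<bullet> l" using gap by blast
    have "b * (exp (p \<bullet> l) * exp (d * norm (real_matrix V *v l))) \<le>
        Re (Poly_Mapping.lookup g m) * exp (exponent_vec m \<bullet> l)"
      using m g(2) by (intro mult_mono) (auto simp: b_def positive_coeffs_def less_imp_le simp flip: exp_add)
    also have "\<dots> \<le> log_eval g l" using log_eval_ge[OF g(2) m(1)] .
    finally show "exp (p \<bullet> l) / log_eval g l \<le> 1 / b * exp (- d * norm (real_matrix V *v l))"
      using log_eval_pos[OF g(2,3), of l] b by (simp add: field_simps exp_minus)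
  qed
qed


section \<open>The canonical form as a pullback\<close>

lemma cox_map_has_derivative:
  fixes V :: "int ^ 'k::finite ^ 'n::finite"
  assumes x: "x \<in> positive_orthant"
  shows "(cox_map V has_derivative
    (\<lambda>w. \<chi> j. cox_map V x $ j * (\<Sum>i\<in>UNIV. real_of_int (V $ j $ i) * dlog x i w))) (at x)"
proof -
  have pos: "x $ i > 0" for i using x by (simp add: positive_orthant_def)
  let ?F = "\<lambda>x. \<chi> j. exp (\<Sum>i\<in>UNIV. real_of_int (V $ j $ i) * ln (x $ i))"
  have eq: "cox_map V z = ?F z" if "z \<in> positive_orthant" for z
    using cox_map_eq_exp[OF that]
    by (simp add: exp_vec_def real_matrix_def log_vec_def matrix_vector_mult_def)
  have "(?F has_derivative (\<lambda>w. \<chi> j. ?F x $ j * (\<Sum>i\<in>UNIV. real_of_int (V $ j $ i) * dlog x i w))) (at x)"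
    unfolding has_derivative_componentwise_within[of ?F]
  proof
    fix b :: "real ^ 'n" assume "b \<in> Basis"
    then obtain j where b: "b = axis j 1" by (auto simp: Basis_vec_def)
    have "((\<lambda>x. exp (\<Sum>i\<in>UNIV. real_of_int (V $ j $ i) * ln (x $ i))) has_derivative
        (\<lambda>w. ?F x $ j * (\<Sum>i\<in>UNIV. real_of_int (V $ j $ i) * dlog x i w))) (at x)"
      using pos
      by (auto simp: dlog_def divide_inverse mult_ac intro!: derivative_eq_intros sum.cong
          bounded_linear_imp_has_derivative[OF bounded_linear_vec_nth])
    then show "((\<lambda>x. ?F x \<bullet> b) has_derivative
        (\<lambda>w. (\<chi> j. ?F x $ j * (\<Sum>i\<in>UNIV. real_of_int (V $ j $ i) * dlog x i w)) \<bullet> b)) (at x)"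
      by (simp add: b inner_axis)
  qed
  then have "(?F has_derivative (\<lambda>w. \<chi> j. cox_map V x $ j * (\<Sum>i\<in>UNIV. real_of_int (V $ j $ i) * dlog x i w))) (at x)"
    by (simp add: eq[OF x])
  then show ?thesis
    by (rule has_derivative_transform_within_open[OF _ open_positive_orthant x]) (simp add: eq)
qed

text \<open>
  The pullback of \<open>dt\<^sub>j/t\<^sub>j\<close> is the combination of the \<open>dx\<^sub>i/x\<^sub>i\<close> with the coefficients of row \<open>j\<close> of \<open>V\<close>.
  The wedge of these n forms is therefore a determinant of a product of an n by k and a k by n
  matrix, and Cauchy--Binet expands it into the defining sum of the canonical form.
\<close>

lemma canonical_form_eq_pullback:
  fixes V :: "int ^ 'k::finite ^ 'n::finite"
  assumes x: "x \<in> positive_orthant"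
  shows "pullback (cox_map V) (\<lambda>t. wedge (dlog t)) x w = canonical_form V x w"
proof -
  define B where "B = (\<chi> i a. dlog x i (w a))"
  define e where "e I = (SOME e :: 'n \<Rightarrow> 'k. bij_betw e UNIV I)" for I
  have e: "bij_betw (e I) UNIV I" if "card I = CARD('n)" for I
  proof -
    have "\<exists>e :: 'n \<Rightarrow> 'k. bij_betw e UNIV I"
      using that by (intro finite_same_card_bij) auto
    then show ?thesis unfolding e_def by (rule someI_ex)
  qed
  have y: "cox_map V x $ j \<noteq> 0" for j
    using exp_vec_pos[of "real_matrix V *v log_vec x"] cox_map_eq_exp[OF x, of V]
    by (simp add: positive_orthant_def less_imp_neq[symmetric])
  have "dlog (cox_map V x) b (frechet_derivative (cox_map V) (at x) (w a)) =
      (real_matrix V ** B) $ b $ a" for a b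
    using y by (simp add: frechet_derivative_at[OF cox_map_has_derivative[OF x], symmetric]
        dlog_def[of "cox_map V x"] B_def real_matrix_def matrix_matrix_mult_def)
  then have "pullback (cox_map V) (\<lambda>t. wedge (dlog t)) x w = det (transpose (real_matrix V ** B))"
    by (simp add: pullback_def wedge_def transpose_def)
  also have "\<dots> = (\<Sum>I | card I = CARD('n).
      det (\<chi> a b. real_matrix V $ a $ e I b) * det (\<chi> a. B $ e I a))"
    unfolding det_transpose by (rule Cauchy_Binet[OF e])
  also have "\<dots> = canonical_form V x w"
    unfolding canonical_form_def Let_def
  proof (intro sum.cong refl arg_cong2[where f = "(*)"])
    fix I :: "'k set"
    have "(\<chi> a b. real_matrix V $ a $ e I b) = real_matrix (\<chi> a b. V $ a $ e I b)"
      by (simp add: real_matrix_def)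
    then show "det (\<chi> a b. real_matrix V $ a $ e I b) =
        real_of_int (det (\<chi> a b. V $ a $ (SOME e :: 'n \<Rightarrow> 'k. bij_betw e UNIV I) b))"
      by (simp add: det_def real_matrix_def e_def)
    have "transpose (\<chi> a. B $ e I a) = (\<chi> a b. dlog x (e I b) (w a))"
      by (simp add: transpose_def B_def)
    then show "det (\<chi> a. B $ e I a) =
        wedge (\<lambda>b. dlog x ((SOME e :: 'n \<Rightarrow> 'k. bij_betw e UNIV I) b)) w"
      by (metis det_transpose e_def wedge_def)
  qed
  finally show ?thesis .
qed


section \<open>Convergence of the integral\<close>

theorem theorem2p5:
  fixes \<F> :: "(real ^ 'n::finite) set set"
    and V :: "int ^ 'k::finite ^ 'n"
    and f g :: "'k cox_ring"
    and D :: "(int ^ 'k) set"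
  assumes "complete_fan \<F>"
    and "ray_matrix \<F> V"
    and "f \<noteq> 0" and "g \<noteq> 0"
    and "positive_coeffs f" and "positive_coeffs g"
    and "D \<in> class_group V"
    and "homogeneous V D f" and "homogeneous V D g"
    and "aff_dim (newton_polytope g) = int CARD('n)"
    and "newton_polytope f \<subseteq> rel_interior (newton_polytope g)"
  shows "integral_converges V (cox_integrand V f g)"
proof -
  let ?A = "real_matrix V"
  obtain m0 where m0: "m0 \<in> Poly_Mapping.keys g" using \<open>g \<noteq> 0\<close> by fastforce
  have "surj ((*v) ?A)"
    using full_dim_newton_polytope(1)[OF assms(9) m0 assms(10)] full_rank_surjective by blast
  then obtain R where R: "?A ** R = mat 1" using matrix_right_invertible_surjective by blast
  have AR: "?A *v (R *v y) = y" for y by (simp add: matrix_vector_mul_assoc R)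
  \<comment> \<open>\<open>exp_vec (R *v log_vec t)\<close> is a point of the fibre over \<open>t\<close>, so \<open>F\<close> is \<open>f/g\<close> as a function of \<open>t\<close>.\<close>
  define F where "F t = log_eval f (R *v log_vec t) / log_eval g (R *v log_vec t)" for t
  define \<omega> :: "('n, 'n, complex) diff_form"
    where "\<omega> t w = of_real (F t) * of_real (wedge (dlog t) w)" for t w
  have "positive_part V = positive_orthant"
  proof
    show "positive_part V \<subseteq> positive_orthant"
      by (auto simp: positive_part_def cox_map_eq_exp exp_vec_pos)
    show "positive_orthant \<subseteq> positive_part V"
    proof
      fix t :: "real ^ 'n" assume "t \<in> positive_orthant"
      then have "t = cox_map V (exp_vec (R *v log_vec t))"
        by (simp add: cox_map_eq_exp exp_vec_pos AR)
      then show "t \<in> positive_part V" unfolding positive_part_def using exp_vec_pos by blast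
    qed
  qed
  moreover have "descends_to V (cox_integrand V f g) \<omega>"
    unfolding descends_to_def
  proof (intro ballI allI)
    fix x :: "real ^ 'k" and w :: "'n \<Rightarrow> real ^ 'k"
    assume x: "x \<in> positive_orthant"
    have "F (cox_map V x) = log_eval f (log_vec x) / log_eval g (log_vec x)"
      unfolding F_def by (rule ratio_fibre[OF assms(8,9,4)]) (simp add: AR cox_map_eq_exp[OF x])
    then show "pullback (cox_map V) \<omega> x w = cox_integrand V f g x w"
      using canonical_form_eq_pullback[OF x, of V w]
      by (simp add: pullback_def \<omega>_def cox_integrand_def eval_poly_positive assms x)
  qed
  moreover have "form_integrable positive_orthant \<omega>"
  proof -
    have coeff: "\<omega> t (\<lambda>j. axis j 1) = of_real (F t / (\<Prod>j\<in>UNIV. t $ j))" for t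
    proof -
      have "wedge (dlog t) (\<lambda>j. axis j 1) = det (\<chi> a b. if a = b then 1 / t $ b else 0)"
        unfolding wedge_def by (intro arg_cong[where f = det]) (simp add: vec_eq_iff dlog_def axis_def)
      also have "\<dots> = (\<Prod>j\<in>UNIV. 1 / t $ j)" by (subst det_diagonal) auto
      finally show ?thesis by (simp add: \<omega>_def prod_dividef)
    qed
    \<comment> \<open>Each monomial of \<open>f\<close> decays at its own rate, so integrability is shown term by term.\<close>
    have term_int: "set_integrable lborel positive_orthant
        (\<lambda>t. exp (exponent_vec m \<bullet> (R *v log_vec t)) / log_eval g (R *v log_vec t) / (\<Prod>j\<in>UNIV. t $ j))"
      (is "set_integrable lborel _ ?h")
      if m: "m \<in> Poly_Mapping.keys f" for m
    proof -
      have "exponent_vec m \<in> newton_polytope f"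
        unfolding newton_polytope_eq using m by (intro hull_inc) auto
      then have "exponent_vec m \<in> rel_interior (newton_polytope g)" using assms(11) by blast
      then obtain d C where d: "d > 0" and bound:
        "\<And>l. exp (exponent_vec m \<bullet> l) / log_eval g l \<le> C * exp (- d * norm (?A *v l))"
        using exp_exponent_ratio_bound[OF assms(9,6,4,10)] by metis
      have "set_integrable lborel positive_orthant
          (\<lambda>t :: real ^ 'n. C * (exp (- d * norm (log_vec t)) / (\<Prod>j\<in>UNIV. t $ j)))"
        using exp_neg_norm_log_integrable[OF d] by (rule set_integrable_mult_right)
      then show ?thesis
      proof (rule set_integrable_bound)
        show "set_borel_measurable lborel positive_orthant ?h"
          unfolding set_borel_measurable_def measurable_lborel2
        proof (intro borel_measurable_continuous_on_indicator)
          have log: "continuous_on positive_orthant (\<lambda>t :: real ^ 'n. R *v log_vec t)"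
            unfolding log_vec_def
            by (intro linear_continuous_on_compose[where g = "(*v) R"] continuous_intros matrix_vector_mul_linear)
              (auto simp: positive_orthant_def less_imp_neq[symmetric])
          have "continuous_on positive_orthant (\<lambda>t :: real ^ 'n. log_eval g (R *v log_vec t))"
            unfolding log_eval_def by (intro continuous_intros log)
          moreover have "log_eval g l \<noteq> 0" for l
            using log_eval_pos[OF assms(6,4), of l] by simp
          ultimately show "continuous_on positive_orthant ?h"
            by (intro continuous_intros log) (auto simp: positive_orthant_def less_imp_neq[symmetric])
          show "(positive_orthant :: (real ^ 'n) set) \<in> sets borel"
            by (intro borel_open open_positive_orthant)
        qed
        show "AE t in lborel. t \<in> positive_orthant \<longrightarrow>
            norm (?h t) \<le> norm (C * (exp (- d * norm (log_vec t)) / (\<Prod>j\<in>UNIV. t $ j)))"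
        proof (intro AE_I2 impI)
          fix t :: "real ^ 'n" assume "t \<in> positive_orthant"
          then have t: "(\<Prod>j\<in>UNIV. t $ j) > 0" by (auto simp: positive_orthant_def intro: prod_pos)
          have g0: "log_eval g (R *v log_vec t) > 0" using log_eval_pos assms by blast
          have "norm (?h t) = ?h t" using t g0 by simp
          also have "\<dots> \<le> C * exp (- d * norm (log_vec t)) / (\<Prod>j\<in>UNIV. t $ j)"
            using bound[of "R *v log_vec t"] t by (intro divide_right_mono) (auto simp: AR)
          also have "\<dots> \<le> norm (C * (exp (- d * norm (log_vec t)) / (\<Prod>j\<in>UNIV. t $ j)))"
            by (simp only: times_divide_eq_right real_norm_def abs_ge_self)
          finally show "norm (?h t) \<le> \<dots>" .
        qed
      qed
    qed
    have "F t / (\<Prod>j\<in>UNIV. t $ j) = (\<Sum>m\<in>Poly_Mapping.keys f. Re (Poly_Mapping.lookup f m) *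
        (exp (exponent_vec m \<bullet> (R *v log_vec t)) / log_eval g (R *v log_vec t) / (\<Prod>j\<in>UNIV. t $ j)))" for t
      by (simp add: F_def log_eval_def[of f] sum_divide_distrib)
    moreover have "set_integrable lborel positive_orthant (\<lambda>t. \<Sum>m\<in>Poly_Mapping.keys f. Re (Poly_Mapping.lookup f m) *
        (exp (exponent_vec m \<bullet> (R *v log_vec t)) / log_eval g (R *v log_vec t) / (\<Prod>j\<in>UNIV. t $ j)))"
      unfolding set_integrable_def scaleR_sum_right
    proof (rule Bochner_Integration.integrable_sum)
      fix m assume "m \<in> Poly_Mapping.keys f"
      from set_integrable_mult_right[OF term_int[OF this], of "Re (Poly_Mapping.lookup f m)"]
      show "integrable lborel (\<lambda>t. indicat_real positive_orthant t *\<^sub>R (Re (Poly_Mapping.lookup f m) *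
          (exp (exponent_vec m \<bullet> (R *v log_vec t)) / log_eval g (R *v log_vec t) / (\<Prod>j\<in>UNIV. t $ j))))"
        unfolding set_integrable_def .
    qed
    ultimately have "set_integrable lborel positive_orthant (\<lambda>t. F t / (\<Prod>j\<in>UNIV. t $ j))"
      by (simp only:)
    then have "integrable lborel (\<lambda>t. complex_of_real
        (indicat_real positive_orthant t *\<^sub>R (F t / (\<Prod>j\<in>UNIV. t $ j))))"
      unfolding set_integrable_def by (rule integrable_of_real)
    then show ?thesis
      unfolding form_integrable_def coeff set_integrable_def
      by (simp add: scaleR_conv_of_real)
  qed
  ultimately show ?thesis unfolding integral_converges_def by metis
qed

end
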